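(* Let $d\ge 2$ and $2\le m\le d+1$ be integers, let $\mathbf p=\{p_1,\dots,p_m\}$ be nonnegative integers with $p_1\le p_2\le\dots\le p_m$, and let $n$ be a nonnegative integer with $\binom{n+d}{d}=\sum_{q=1}^m\binom{p_q+d}{d}$. Except in the Lagrange case (all $p_q=0$), the Hermite interpolation scheme $\mathbf p$ of type total degree in $\mathbb R^d$ is singular.
   Context: $\Pi_n^d$ denotes the space of real polynomials in $d$ variables of total degree at most $n$. Let $\mathbf p=\{p_1,\dots,p_m\}$ be nonnegative integers and let $n$ satisfy $\binom{n+d}{d}=\sum_{q=1}^m\binom{p_q+d}{d}$. For a set $\mathcal X=\{X_1,\dots,X_m\}$ of pairwise distinct points in $\mathbb R^d$, the Hermite interpolation problem of type total degree $(\mathbf p,\mathcal X)$ is: find $f\in\Pi_n^d$ with $\frac{\partial^{|\alpha|}f}{\partial x_1^{\alpha_1}\cdots\partial x_d^{\alpha_d}}(X_q)=c_{q,\alpha}$ for all $1\le q\le m$ and all $\alpha\in\mathbb N_0^d$ with $0\le|\alpha|=\alpha_1+\dots+\alpha_d\le p_q$. The problem $(\mathbf p,\mathcal X)$ is regular if it has a unique solution for every choice of real values $c_{q,\alpha}$, and singular otherwise. The scheme $\mathbf p$ is singular if $(\mathbf p,\mathcal X)$ is singular for all sets $\mathcal X$ of $m$ pairwise distinct points. *)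

theory Defs
  imports "HOL-Analysis.Analysis"
begin

definition mi_abs :: "('d::finite \<Rightarrow> nat) \<Rightarrow> nat" where
  "mi_abs \<alpha> = (\<Sum>i\<in>UNIV. \<alpha> i)"

definition mi_monom :: "('d::finite \<Rightarrow> nat) \<Rightarrow> real ^ 'd \<Rightarrow> real" where
  "mi_monom \<alpha> x = (\<Prod>i\<in>UNIV. (x $ i) ^ \<alpha> i)"

text \<open>The space of real polynomials in \<open>CARD('d)\<close> variables of total degree at most \<open>n\<close>.
  Over the reals a polynomial may be identified with its polynomial function.\<close>

definition polys_upto :: "nat \<Rightarrow> (real ^ 'd::finite \<Rightarrow> real) set" where
  "polys_upto n = {f. \<exists>c. f = (\<lambda>x. \<Sum>\<alpha> | mi_abs \<alpha> \<le> n. c \<alpha> * mi_monom \<alpha> x)}"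

definition partial_deriv :: "'d::finite \<Rightarrow> (real ^ 'd \<Rightarrow> real) \<Rightarrow> real ^ 'd \<Rightarrow> real" where
  "partial_deriv i f x = deriv (\<lambda>t. f (x + t *\<^sub>R axis i 1)) 0"

definition mixed_deriv_along ::
  "'d::finite list \<Rightarrow> ('d \<Rightarrow> nat) \<Rightarrow> (real ^ 'd \<Rightarrow> real) \<Rightarrow> real ^ 'd \<Rightarrow> real" where
  "mixed_deriv_along ks \<alpha> f = foldr (\<lambda>i. partial_deriv i ^^ \<alpha> i) ks f"

text \<open>A finite index type carries no canonical order, so some enumeration of the
  coordinates is chosen. For polynomials the choice is irrelevant: see
  \<open>mixed_deriv_enumeration\<close> below.\<close>

definition mixed_deriv ::
  "('d::finite \<Rightarrow> nat) \<Rightarrow> (real ^ 'd \<Rightarrow> real) \<Rightarrow> real ^ 'd \<Rightarrow> real" where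
  "mixed_deriv = mixed_deriv_along (SOME ks. distinct ks \<and> set ks = UNIV)"

definition hermite_solution ::
  "nat \<Rightarrow> nat \<Rightarrow> (nat \<Rightarrow> nat) \<Rightarrow> (nat \<Rightarrow> real ^ 'd::finite) \<Rightarrow>
    (nat \<Rightarrow> ('d \<Rightarrow> nat) \<Rightarrow> real) \<Rightarrow> (real ^ 'd \<Rightarrow> real) \<Rightarrow> bool" where
  "hermite_solution n m p X c f \<longleftrightarrow>
     f \<in> polys_upto n \<and>
     (\<forall>q\<in>{1..m}. \<forall>\<alpha>. mi_abs \<alpha> \<le> p q \<longrightarrow> mixed_deriv \<alpha> f (X q) = c q \<alpha>)"

definition hermite_regular ::
  "nat \<Rightarrow> nat \<Rightarrow> (nat \<Rightarrow> nat) \<Rightarrow> (nat \<Rightarrow> real ^ 'd::finite) \<Rightarrow> bool" where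
  "hermite_regular n m p X \<longleftrightarrow> (\<forall>c. \<exists>!f. hermite_solution n m p X c f)"

text \<open>The \<open>'d itself\<close> argument carries the dimension \<open>CARD('d)\<close> of the ambient space.\<close>

definition scheme_singular ::
  "'d::finite itself \<Rightarrow> nat \<Rightarrow> nat \<Rightarrow> (nat \<Rightarrow> nat) \<Rightarrow> bool" where
  "scheme_singular _ n m p \<longleftrightarrow>
     (\<forall>X :: nat \<Rightarrow> real ^ 'd. inj_on X {1..m} \<longrightarrow> \<not> hermite_regular n m p X)"

lemma finite_mi_abs_le: "finite {\<alpha> :: 'd::finite \<Rightarrow> nat. mi_abs \<alpha> \<le> n}"
proof (rule finite_subset)
  show "{\<alpha> :: 'd \<Rightarrow> nat. mi_abs \<alpha> \<le> n} \<subseteq> PiE UNIV (\<lambda>_. {..n})"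
    unfolding mi_abs_def
    by (auto simp: PiE_def) (metis finite member_le_sum UNIV_I le0 order_trans)
  show "finite (PiE (UNIV :: 'd set) (\<lambda>_. {..n}))"
    by (intro finite_PiE) auto
qed

lemma mi_monom_has_partial:
  "((\<lambda>t. mi_monom \<alpha> (x + t *\<^sub>R axis i 1)) has_field_derivative
     of_nat (\<alpha> i) * mi_monom (\<alpha>(i := \<alpha> i - 1)) x) (at 0)"
proof -
  have *: "mi_monom \<beta> y = (y $ i) ^ \<beta> i * (\<Prod>j\<in>UNIV - {i}. (y $ j) ^ \<beta> j)" for \<beta> y
    unfolding mi_monom_def by (simp add: prod.remove)
  have "mi_monom \<alpha> (x + t *\<^sub>R axis i 1) = (x $ i + t) ^ \<alpha> i * (\<Prod>j\<in>UNIV - {i}. (x $ j) ^ \<alpha> j)" for t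
    unfolding * by (auto simp: axis_def intro!: prod.cong)
  moreover have "((\<lambda>t. (x $ i + t) ^ \<alpha> i * (\<Prod>j\<in>UNIV - {i}. (x $ j) ^ \<alpha> j))
      has_field_derivative of_nat (\<alpha> i) * mi_monom (\<alpha>(i := \<alpha> i - 1)) x) (at 0)"
    by (auto simp: * intro!: derivative_eq_intros prod.cong)
  ultimately show ?thesis by simp
qed

lemma partial_deriv_poly:
  fixes c :: "('d::finite \<Rightarrow> nat) \<Rightarrow> real"
  shows "partial_deriv i (\<lambda>x. \<Sum>\<alpha>\<in>A. c \<alpha> * mi_monom (s \<alpha>) x) =
    (\<lambda>x. \<Sum>\<alpha>\<in>A. (c \<alpha> * of_nat (s \<alpha> i)) * mi_monom ((s \<alpha>)(i := s \<alpha> i - 1)) x)"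
  unfolding partial_deriv_def
  by (intro ext DERIV_imp_deriv)
     (auto intro!: derivative_eq_intros mi_monom_has_partial sum.cong simp: mult_ac)

text \<open>Polynomial functions as sums of terms with possibly repeated exponents: lowering
  exponents under differentiation only changes \<open>c\<close> and \<open>s\<close>, so terms need not be merged.\<close>

definition poly_rep :: "(real ^ 'd::finite \<Rightarrow> real) \<Rightarrow> bool" where
  "poly_rep f \<longleftrightarrow> (\<exists>(A :: ('d \<Rightarrow> nat) set) c s. f = (\<lambda>x. \<Sum>\<alpha>\<in>A. c \<alpha> * mi_monom (s \<alpha>) x))"

lemma poly_rep_polys_upto: "f \<in> polys_upto n \<Longrightarrow> poly_rep f"
  unfolding polys_upto_def poly_rep_def by (auto intro!: exI[of _ "\<lambda>x. x"])

lemma poly_rep_partial: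
  fixes f :: "real ^ 'd::finite \<Rightarrow> real"
  shows "poly_rep f \<Longrightarrow> poly_rep (partial_deriv i f)"
  unfolding poly_rep_def
proof (elim exE)
  fix A :: "('d \<Rightarrow> nat) set" and c and s :: "('d \<Rightarrow> nat) \<Rightarrow> 'd \<Rightarrow> nat"
  assume "f = (\<lambda>x. \<Sum>\<alpha>\<in>A. c \<alpha> * mi_monom (s \<alpha>) x)"
  then have "partial_deriv i f = (\<lambda>x. \<Sum>\<alpha>\<in>A. (c \<alpha> * of_nat (s \<alpha> i)) *
      mi_monom ((\<lambda>\<alpha>. (s \<alpha>)(i := s \<alpha> i - 1)) \<alpha>) x)"
    by (simp only: partial_deriv_poly)
  then show "\<exists>(A :: ('d \<Rightarrow> nat) set) c s. partial_deriv i f = (\<lambda>x. \<Sum>\<alpha>\<in>A. c \<alpha> * mi_monom (s \<alpha>) x)"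
    by (intro exI[of _ A] exI[of _ "\<lambda>\<alpha>. c \<alpha> * of_nat (s \<alpha> i)"]
        exI[of _ "\<lambda>\<alpha>. (s \<alpha>)(i := s \<alpha> i - 1)"])
qed

lemma poly_rep_partial_iter: "poly_rep f \<Longrightarrow> poly_rep ((partial_deriv i ^^ k) f)"
  by (induction k) (auto intro: poly_rep_partial)

lemma poly_rep_mixed: "poly_rep f \<Longrightarrow> poly_rep (mixed_deriv_along ks \<alpha> f)"
  unfolding mixed_deriv_along_def by (induction ks) (auto intro: poly_rep_partial_iter)

lemma partial_deriv_commute:
  fixes f :: "real ^ 'd::finite \<Rightarrow> real"
  assumes "poly_rep f"
  shows "partial_deriv i (partial_deriv j f) = partial_deriv j (partial_deriv i f)"
proof (cases "i = j")
  case False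
  obtain A :: "('d \<Rightarrow> nat) set" and c s where "f = (\<lambda>x. \<Sum>\<alpha>\<in>A. c \<alpha> * mi_monom (s \<alpha>) x)"
    using assms unfolding poly_rep_def by blast
  then have eq: "partial_deriv k (partial_deriv l f) = (\<lambda>x. \<Sum>\<alpha>\<in>A.
      (c \<alpha> * of_nat (s \<alpha> l) * of_nat (((s \<alpha>)(l := s \<alpha> l - 1)) k)) *
      mi_monom ((s \<alpha>)(l := s \<alpha> l - 1, k := ((s \<alpha>)(l := s \<alpha> l - 1)) k - 1)) x)" for k l
    by (simp only: partial_deriv_poly)
  show ?thesis using False
    unfolding eq by (intro ext sum.cong refl) (simp add: fun_upd_twist mult_ac)
qed simp

lemma partial_deriv_commute_iter1:
  assumes "poly_rep f"
  shows "partial_deriv i ((partial_deriv j ^^ k) f) = (partial_deriv j ^^ k) (partial_deriv i f)"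
  by (induction k) (simp_all add: partial_deriv_commute[of _ i j] poly_rep_partial_iter assms)

lemma partial_deriv_commute_iter:
  assumes "poly_rep f"
  shows "(partial_deriv i ^^ l) ((partial_deriv j ^^ k) f) =
         (partial_deriv j ^^ k) ((partial_deriv i ^^ l) f)"
  by (induction l)
     (simp_all add: partial_deriv_commute_iter1 poly_rep_partial_iter assms)

lemma mixed_deriv_along_remove1:
  assumes "poly_rep f" "i \<in> set js"
  shows "mixed_deriv_along js \<alpha> f =
         (partial_deriv i ^^ \<alpha> i) (mixed_deriv_along (remove1 i js) \<alpha> f)"
  using assms(2)
proof (induction js)
  case (Cons j js)
  then show ?case
    using partial_deriv_commute_iter[OF poly_rep_mixed[OF assms(1)]]
    by (auto simp: mixed_deriv_along_def)
qed simp

lemma mixed_deriv_along_perm: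
  assumes "poly_rep f"
  shows "distinct ks \<Longrightarrow> distinct js \<Longrightarrow> set ks = set js \<Longrightarrow>
    mixed_deriv_along ks \<alpha> f = mixed_deriv_along js \<alpha> f"
proof (induction ks arbitrary: js)
  case (Cons i ks)
  have "mixed_deriv_along ks \<alpha> f = mixed_deriv_along (remove1 i js) \<alpha> f"
    using Cons.prems by (intro Cons.IH) auto
  moreover have "i \<in> set js" using Cons.prems(3) by auto
  ultimately show ?case
    using mixed_deriv_along_remove1[OF assms, of i js \<alpha>]
    by (simp add: mixed_deriv_along_def)
qed simp

lemma mixed_deriv_enumeration:
  fixes f :: "real ^ 'd::finite \<Rightarrow> real"
  assumes "f \<in> polys_upto n" "distinct ks" "set ks = UNIV"
  shows "mixed_deriv \<alpha> f = mixed_deriv_along ks \<alpha> f"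
proof -
  have "\<exists>ks. distinct ks \<and> set ks = (UNIV :: 'd set)"
    using finite_distinct_list[of "UNIV :: 'd set"] by auto
  then have "distinct (SOME ks. distinct ks \<and> set ks = (UNIV :: 'd set)) \<and>
      set (SOME ks. distinct ks \<and> set ks = (UNIV :: 'd set)) = UNIV"
    by (rule someI_ex)
  then show ?thesis
    unfolding mixed_deriv_def
    using mixed_deriv_along_perm[OF poly_rep_polys_upto[OF assms(1)]] assms(2,3) by metis
qed

end

theory Submission
  imports Defs
begin

text \<open>
  Write \<open>d\<close> for the dimension. It suffices to break uniqueness: a nonzero polynomial of degree
  at most \<open>n\<close> that vanishes to order \<open>p\<^sub>q + 1\<close> at every node \<open>X\<^sub>q\<close> solves the same problem as
  the zero polynomial (\<open>not_hermite_regular_if_nonzero_vanishing\<close>). Such a polynomial is found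
  among the products of \<open>n\<close> affine functions, because a product vanishes at a node at least to
  the order given by the number of its factors that vanish there (\<open>vanishes_to_mult\<close>).
  Comparing the dimension count with a single summand gives \<open>p\<^sub>q < n\<close> for all \<open>q\<close>.

  If all nodes lie on one hyperplane \<open>l = 0\<close>, the power \<open>l ^ n\<close> is such a polynomial. At most
  \<open>d\<close> points always lie on a hyperplane, so the case \<open>m = d + 1\<close> with nodes that lie on no
  common hyperplane remains. For each \<open>q\<close> some affine \<open>l\<^sub>q\<close> vanishes at all nodes other than
  \<open>X\<^sub>q\<close>; up to scaling, the \<open>l\<^sub>q\<close> are the barycentric coordinates of the simplex spanned by the
  nodes. The product of the powers \<open>l\<^sub>q ^ \<beta>\<^sub>q\<close> with exponent sum \<open>n\<close> vanishes to order
  \<open>n - \<beta>\<^sub>q\<close> at \<open>X\<^sub>q\<close>, so exponents with \<open>\<beta>\<^sub>q + p\<^sub>q < n\<close> for all \<open>q\<close> are wanted.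

  They exist by counting (\<open>exists_exponents\<close>). Let \<open>A\<^sub>q\<close> be the set of the exponent vectors with
  sum \<open>n\<close> and \<open>\<beta>\<^sub>q \<ge> n - p\<^sub>q\<close>; it has \<open>(p\<^sub>q + d) choose d\<close> elements. If no suitable vector existed,
  the \<open>A\<^sub>q\<close> would cover all \<open>(n + d) choose d\<close> exponent vectors, and since by hypothesis their
  sizes add up to exactly that number, they would be pairwise disjoint. Disjointness of \<open>A\<^sub>a\<close> and
  \<open>A\<^sub>b\<close> means \<open>p\<^sub>a + p\<^sub>b < n\<close>. Then any three coordinates, which are available as \<open>d \<ge> 2\<close>, leave
  enough room for an exponent vector outside all \<open>A\<^sub>q\<close>, as soon as \<open>n \<ge> 2\<close>; and \<open>n \<ge> 2\<close> holds
  outside the Lagrange case, where some \<open>p\<^sub>q\<close> satisfies \<open>1 \<le> p\<^sub>q < n\<close>.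
\<close>

section \<open>Polynomials of bounded total degree\<close>

lemma polys_upto_add:
  assumes "f \<in> polys_upto n" "g \<in> polys_upto n"
  shows "(\<lambda>x. f x + g x) \<in> polys_upto n"
proof -
  obtain a b where "f = (\<lambda>x. \<Sum>\<alpha> | mi_abs \<alpha> \<le> n. a \<alpha> * mi_monom \<alpha> x)"
    "g = (\<lambda>x. \<Sum>\<alpha> | mi_abs \<alpha> \<le> n. b \<alpha> * mi_monom \<alpha> x)"
    using assms unfolding polys_upto_def by blast
  then show ?thesis
    unfolding polys_upto_def
    by (intro CollectI exI[of _ "\<lambda>\<alpha>. a \<alpha> + b \<alpha>"]) (simp add: sum.distrib distrib_right)
qed

lemma polys_upto_scale:
  assumes "f \<in> polys_upto n"
  shows "(\<lambda>x. k * f x) \<in> polys_upto n"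
proof -
  obtain a where "f = (\<lambda>x. \<Sum>\<alpha> | mi_abs \<alpha> \<le> n. a \<alpha> * mi_monom \<alpha> x)"
    using assms unfolding polys_upto_def by blast
  then show ?thesis
    unfolding polys_upto_def
    by (intro CollectI exI[of _ "\<lambda>\<alpha>. k * a \<alpha>"]) (simp add: sum_distrib_left mult.assoc)
qed

lemma polys_upto_zero: "(\<lambda>x. 0) \<in> polys_upto n"
  unfolding polys_upto_def by (intro CollectI exI[of _ "\<lambda>_. 0"]) simp

lemma polys_upto_sum:
  assumes "\<And>i. i \<in> I \<Longrightarrow> f i \<in> polys_upto n"
  shows "(\<lambda>x. \<Sum>i\<in>I. f i x) \<in> polys_upto n"
  using assms
  by (induction I rule: infinite_finite_induct) (auto intro: polys_upto_zero polys_upto_add)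

lemma polys_upto_monom:
  assumes "mi_abs \<alpha> \<le> n"
  shows "mi_monom \<alpha> \<in> polys_upto n"
proof -
  have "mi_monom \<alpha> x = (\<Sum>\<beta> | mi_abs \<beta> \<le> n. (if \<beta> = \<alpha> then 1 else 0) * mi_monom \<beta> x)" for x
    using assms by (simp add: if_distrib[of "\<lambda>c. c * _"] finite_mi_abs_le cong: if_cong)
  then show ?thesis
    unfolding polys_upto_def by (intro CollectI exI[of _ "\<lambda>\<beta>. if \<beta> = \<alpha> then 1 else 0"]) auto
qed

lemma polys_upto_const: "(\<lambda>x. k) \<in> polys_upto n"
proof -
  have "(\<lambda>x. k * mi_monom (\<lambda>_. 0) x) \<in> polys_upto n"
    by (intro polys_upto_scale polys_upto_monom) (simp add: mi_abs_def)
  then show ?thesis by (simp add: mi_monom_def)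
qed

lemma polys_upto_mult_monom:
  assumes "f \<in> polys_upto n" "mi_abs \<beta> + n \<le> k"
  shows "(\<lambda>x. mi_monom \<beta> x * f x) \<in> polys_upto k"
proof -
  obtain a where a: "f = (\<lambda>x. \<Sum>\<alpha> | mi_abs \<alpha> \<le> n. a \<alpha> * mi_monom \<alpha> x)"
    using assms unfolding polys_upto_def by blast
  have "mi_monom \<beta> x * mi_monom \<alpha> x = mi_monom (\<lambda>i. \<beta> i + \<alpha> i) x" for \<alpha> x
    by (simp add: mi_monom_def power_add prod.distrib)
  then have "(\<lambda>x. mi_monom \<beta> x * f x) =
      (\<lambda>x. \<Sum>\<alpha> | mi_abs \<alpha> \<le> n. a \<alpha> * mi_monom (\<lambda>i. \<beta> i + \<alpha> i) x)"
    unfolding a by (simp add: sum_distrib_left mult.left_commute)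
  moreover have "\<dots> \<in> polys_upto k"
    using assms(2)
    by (intro polys_upto_sum polys_upto_scale polys_upto_monom)
       (auto simp: mi_abs_def sum.distrib)
  ultimately show ?thesis by simp
qed

lemma polys_upto_mult:
  assumes "f \<in> polys_upto n" "g \<in> polys_upto k"
  shows "(\<lambda>x. f x * g x) \<in> polys_upto (n + k)"
proof -
  obtain a where a: "f = (\<lambda>x. \<Sum>\<alpha> | mi_abs \<alpha> \<le> n. a \<alpha> * mi_monom \<alpha> x)"
    using assms unfolding polys_upto_def by blast
  have "(\<lambda>x. f x * g x) = (\<lambda>x. \<Sum>\<alpha> | mi_abs \<alpha> \<le> n. a \<alpha> * (mi_monom \<alpha> x * g x))"
    unfolding a by (simp add: sum_distrib_right mult.assoc)
  moreover have "\<dots> \<in> polys_upto (n + k)"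
    by (intro polys_upto_sum polys_upto_scale polys_upto_mult_monom[OF assms(2)]) auto
  ultimately show ?thesis by simp
qed

lemma polys_upto_power:
  assumes "f \<in> polys_upto 1"
  shows "(\<lambda>x. f x ^ k) \<in> polys_upto k"
proof (induction k)
  case (Suc k)
  show ?case using polys_upto_mult[OF assms Suc] by simp
qed (simp add: polys_upto_const)

lemma polys_upto_prod:
  assumes "\<And>i. i \<in> I \<Longrightarrow> f i \<in> polys_upto (k i)"
  shows "(\<lambda>x. \<Prod>i\<in>I. f i x) \<in> polys_upto (\<Sum>i\<in>I. k i)"
  using assms
  by (induction I rule: infinite_finite_induct) (auto intro: polys_upto_const polys_upto_mult)

lemma polys_upto_affine: "(\<lambda>x. u \<bullet> x + c) \<in> polys_upto 1"
proof -
  have coord: "(\<lambda>x. x $ i) \<in> polys_upto 1" for i :: 'a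
  proof -
    have "(\<lambda>x :: real ^ 'a. x $ i) = mi_monom (\<lambda>j. if j = i then 1 else 0)"
    proof
      fix x :: "real ^ 'a"
      have "mi_monom (\<lambda>j. if j = i then 1 else 0) x = (\<Prod>j\<in>UNIV. if j = i then x $ j else 1)"
        unfolding mi_monom_def by (intro prod.cong) auto
      then show "x $ i = mi_monom (\<lambda>j. if j = i then 1 else 0) x" by simp
    qed
    moreover have "mi_monom (\<lambda>j. if j = i then 1 else 0) \<in> polys_upto 1"
      by (intro polys_upto_monom) (simp add: mi_abs_def)
    ultimately show ?thesis by simp
  qed
  show ?thesis
    unfolding inner_vec_def inner_real_def
    by (intro polys_upto_add polys_upto_sum polys_upto_scale polys_upto_const coord)
qed

section \<open>Order of vanishing at a point\<close>

text \<open>Differentiability and closure under differentiation are proved by one induction: the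
  derivative of a product involves the factors themselves, so both facts are needed together.\<close>

lemma real_polynomial_function_partial:
  fixes f :: "real ^ 'd::finite \<Rightarrow> real"
  assumes "real_polynomial_function f"
  shows "\<exists>g. real_polynomial_function g \<and>
    (\<forall>x. ((\<lambda>t. f (x + t *\<^sub>R axis i 1)) has_field_derivative g x) (at 0))"
  using assms
proof (induction rule: real_polynomial_function.induct)
  case (linear f)
  interpret bounded_linear f by fact
  show ?case
    by (intro exI[of _ "\<lambda>x. f (axis i 1)"] conjI allI real_polynomial_function.intros(2))
       (auto simp: add scaleR intro!: derivative_eq_intros)
next
  case (const c)
  show ?case
    by (intro exI[of _ "\<lambda>x. 0"]) (auto intro: real_polynomial_function.intros(2))
next
  case (add f g)
  then obtain f' g' where "real_polynomial_function f'" "real_polynomial_function g'"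
    "\<And>x. ((\<lambda>t. f (x + t *\<^sub>R axis i 1)) has_field_derivative f' x) (at 0)"
    "\<And>x. ((\<lambda>t. g (x + t *\<^sub>R axis i 1)) has_field_derivative g' x) (at 0)" by blast
  then show ?case
    by (intro exI[of _ "\<lambda>x. f' x + g' x"])
       (auto intro: real_polynomial_function.intros(3) intro!: derivative_intros)
next
  case (mult f g)
  then obtain f' g' where "real_polynomial_function f'" "real_polynomial_function g'"
    "\<And>x. ((\<lambda>t. f (x + t *\<^sub>R axis i 1)) has_field_derivative f' x) (at 0)"
    "\<And>x. ((\<lambda>t. g (x + t *\<^sub>R axis i 1)) has_field_derivative g' x) (at 0)" by blast
  with mult.hyps show ?case
    by (intro exI[of _ "\<lambda>x. f' x * g x + g' x * f x"])
       (auto intro!: derivative_eq_intros)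
qed

lemma partial_deriv_has_derivative:
  assumes "real_polynomial_function f"
  shows "((\<lambda>t. f (x + t *\<^sub>R axis i 1)) has_field_derivative partial_deriv i f x) (at 0)"
  using real_polynomial_function_partial[OF assms, of i]
  unfolding partial_deriv_def by (metis DERIV_imp_deriv)

lemma real_polynomial_function_partial_deriv:
  assumes "real_polynomial_function f"
  shows "real_polynomial_function (partial_deriv i f)"
proof -
  obtain g where g: "real_polynomial_function g"
    "\<And>x. ((\<lambda>t. f (x + t *\<^sub>R axis i 1)) has_field_derivative g x) (at 0)"
    using real_polynomial_function_partial[OF assms] by blast
  have "partial_deriv i f = g"
    unfolding partial_deriv_def using g(2) by (intro ext DERIV_imp_deriv)
  with g(1) show ?thesis by simp
qed

lemma partial_deriv_add:
  assumes "real_polynomial_function f" "real_polynomial_function g"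
  shows "partial_deriv i (\<lambda>x. f x + g x) = (\<lambda>x. partial_deriv i f x + partial_deriv i g x)"
proof
  fix x
  show "partial_deriv i (\<lambda>x. f x + g x) x = partial_deriv i f x + partial_deriv i g x"
    unfolding partial_deriv_def[of i "\<lambda>x. f x + g x"]
    by (intro DERIV_imp_deriv DERIV_add partial_deriv_has_derivative assms)
qed

lemma partial_deriv_mult:
  assumes "real_polynomial_function f" "real_polynomial_function g"
  shows "partial_deriv i (\<lambda>x. f x * g x) =
    (\<lambda>x. partial_deriv i f x * g x + f x * partial_deriv i g x)"
proof
  fix x
  have "((\<lambda>t. f (x + t *\<^sub>R axis i 1) * g (x + t *\<^sub>R axis i 1)) has_field_derivative
      partial_deriv i f x * g x + f x * partial_deriv i g x) (at 0)"
    using DERIV_mult[OF partial_deriv_has_derivative[OF assms(1), of x i]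
        partial_deriv_has_derivative[OF assms(2), of x i]]
    by (simp add: mult.commute)
  then show "partial_deriv i (\<lambda>x. f x * g x) x =
      partial_deriv i f x * g x + f x * partial_deriv i g x"
    unfolding partial_deriv_def[of i "\<lambda>x. f x * g x"] by (rule DERIV_imp_deriv)
qed

text \<open>All partial derivatives of order less than \<open>k\<close>, in every order of differentiation, are
  zero at \<open>a\<close>. The recursion peels off the innermost derivative, which is what the Leibniz
  rule acts on.\<close>

primrec vanishes_to :: "real ^ 'd::finite \<Rightarrow> nat \<Rightarrow> (real ^ 'd \<Rightarrow> real) \<Rightarrow> bool" where
  "vanishes_to a 0 f \<longleftrightarrow> True"
| "vanishes_to a (Suc k) f \<longleftrightarrow> f a = 0 \<and> (\<forall>i. vanishes_to a k (partial_deriv i f))"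

lemma vanishes_to_mono:
  assumes "vanishes_to a k f" "j \<le> k"
  shows "vanishes_to a j f"
  using assms
proof (induction j arbitrary: k f)
  case (Suc j)
  then obtain k' where "k = Suc k'" by (cases k) auto
  with Suc show ?case by auto
qed simp

lemma vanishes_to_partial_deriv:
  "vanishes_to a k f \<Longrightarrow> vanishes_to a (k - 1) (partial_deriv i f)"
  by (cases k) auto

lemma vanishes_to_add:
  assumes "real_polynomial_function f" "real_polynomial_function g"
    and "vanishes_to a k f" "vanishes_to a k g"
  shows "vanishes_to a k (\<lambda>x. f x + g x)"
  using assms
  by (induction k arbitrary: f g)
     (auto simp: partial_deriv_add real_polynomial_function_partial_deriv)

lemma vanishes_to_zero: "vanishes_to a k (\<lambda>x. 0)"
proof (induction k)
  case (Suc k)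
  have "partial_deriv i (\<lambda>x. 0) = (\<lambda>x. 0)" for i :: 'a
    by (simp add: partial_deriv_def fun_eq_iff)
  with Suc show ?case by simp
qed simp

text \<open>By the Leibniz rule every partial derivative of \<open>f * g\<close> is a sum of two products, in each
  of which one factor has lost one order of vanishing. A factor of order \<open>0\<close> has
  none to lose; when that factor is differentiated, the order of the other one is lowered.\<close>

lemma vanishes_to_mult:
  assumes "real_polynomial_function f" "real_polynomial_function g"
    and "vanishes_to a j f" "vanishes_to a k g"
  shows "vanishes_to a (j + k) (\<lambda>x. f x * g x)"
  using assms
proof (induction "j + k" arbitrary: j k f g)
  case (Suc n)
  note poly = Suc.prems(1,2) real_polynomial_function_partial_deriv[OF Suc.prems(1)]
    real_polynomial_function_partial_deriv[OF Suc.prems(2)]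
  have left: "vanishes_to a n (\<lambda>x. partial_deriv i f x * g x)" for i
  proof (cases j)
    case 0
    then show ?thesis
      using Suc.hyps Suc.prems(4) poly vanishes_to_mono[of a k g n]
        Suc.hyps(1)[of 0 n "partial_deriv i f" g]
      by simp
  next
    case (Suc j')
    then show ?thesis
      using Suc.hyps(1)[of j' k "partial_deriv i f" g] Suc.hyps(2) Suc.prems(3,4) poly
      by simp
  qed
  have right: "vanishes_to a n (\<lambda>x. f x * partial_deriv i g x)" for i
  proof (cases k)
    case 0
    then show ?thesis
      using Suc.hyps Suc.prems(3) poly vanishes_to_mono[of a j f n]
        Suc.hyps(1)[of n 0 f "partial_deriv i g"]
      by simp
  next
    case (Suc k')
    then show ?thesis
      using Suc.hyps(1)[of j k' f "partial_deriv i g"] Suc.hyps(2) Suc.prems(3,4) poly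
      by simp
  qed
  have "vanishes_to a n (partial_deriv i (\<lambda>x. f x * g x))" for i
    unfolding partial_deriv_mult[OF Suc.prems(1,2)]
    by (intro vanishes_to_add left right real_polynomial_function.intros(4) poly)
  moreover have "f a * g a = 0"
    using Suc.hyps(2) Suc.prems(3,4) by (cases j; cases k) auto
  ultimately show ?case
    by (simp flip: Suc.hyps(2))
qed simp

lemma vanishes_to_power:
  assumes "real_polynomial_function f" "f a = 0"
  shows "vanishes_to a k (\<lambda>x. f x ^ k)"
proof (induction k)
  case (Suc k)
  have "vanishes_to a (1 + k) (\<lambda>x. f x * f x ^ k)"
    using assms by (intro vanishes_to_mult Suc real_polynomial_function_power) auto
  then show ?case by simp
qed simp

lemma vanishes_to_prod:
  assumes "finite I" "\<And>i. i \<in> I \<Longrightarrow> real_polynomial_function (f i)"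
    and "\<And>i. i \<in> I \<Longrightarrow> vanishes_to a (k i) (f i)"
  shows "vanishes_to a (\<Sum>i\<in>I. k i) (\<lambda>x. \<Prod>i\<in>I. f i x)"
  using assms
proof (induction I rule: finite_induct)
  case (insert i I)
  have "vanishes_to a (k i + (\<Sum>i\<in>I. k i)) (\<lambda>x. f i x * (\<Prod>i\<in>I. f i x))"
    using insert by (intro vanishes_to_mult real_polynomial_function_prod) auto
  with insert.hyps show ?case by simp
qed simp

text \<open>A mixed derivative is an iterated partial derivative along one particular word of
  coordinates, whose length is \<open>mi_abs \<alpha>\<close>; each letter costs one order of vanishing.\<close>

lemma vanishes_to_mixed_deriv:
  assumes "f \<in> polys_upto n" "vanishes_to a (Suc k) f" "mi_abs \<alpha> \<le> k"
  shows "mixed_deriv \<alpha> f a = 0"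
proof -
  have iter: "vanishes_to a j ((partial_deriv i ^^ l) g)" if "vanishes_to a (j + l) g" for i j l g
    using that
  proof (induction l arbitrary: j)
    case (Suc l)
    have "vanishes_to a (Suc j) ((partial_deriv i ^^ l) g)"
      using Suc.IH[of "Suc j"] Suc.prems by (simp del: vanishes_to.simps)
    then show ?case by simp
  qed simp
  have along: "vanishes_to a j (mixed_deriv_along ks \<alpha> f)"
    if "vanishes_to a (j + sum_list (map \<alpha> ks)) f" for ks j
    using that
  proof (induction ks arbitrary: j)
    case (Cons i ks)
    have "vanishes_to a (j + \<alpha> i) (mixed_deriv_along ks \<alpha> f)"
      using Cons by (simp add: add.assoc)
    then show ?case
      by (simp add: mixed_deriv_along_def iter)
  qed (simp add: mixed_deriv_along_def)
  obtain ks where ks: "distinct ks" "set ks = (UNIV :: 'a set)"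
    using finite_distinct_list[of "UNIV :: 'a set"] by auto
  have "sum_list (map \<alpha> ks) = mi_abs \<alpha>"
    using ks by (simp add: mi_abs_def sum_list_distinct_conv_sum_set)
  then have "vanishes_to a (1 + sum_list (map \<alpha> ks)) f"
    using assms by (auto intro: vanishes_to_mono simp del: vanishes_to.simps)
  from along[OF this] show ?thesis
    using mixed_deriv_enumeration[OF assms(1) ks] by simp
qed

lemma not_hermite_regular_if_nonzero_vanishing:
  assumes "f \<in> polys_upto n" "f z \<noteq> 0"
    and "\<And>q. q \<in> {1..m} \<Longrightarrow> vanishes_to (X q) (Suc (p q)) f"
  shows "\<not> hermite_regular n m p X"
proof
  assume "hermite_regular n m p X"
  then obtain h where h: "\<And>g. hermite_solution n m p X (\<lambda>_ _. 0) g \<Longrightarrow> g = h"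
    unfolding hermite_regular_def by metis
  have solution: "hermite_solution n m p X (\<lambda>_ _. 0) g"
    if "g \<in> polys_upto n" "\<And>q. q \<in> {1..m} \<Longrightarrow> vanishes_to (X q) (Suc (p q)) g" for g
    unfolding hermite_solution_def
    using that(1) vanishes_to_mixed_deriv[OF that(1) that(2)] by simp
  have "f = h"
    by (intro h solution assms)
  moreover have "(\<lambda>x. 0) = h"
    by (intro h solution polys_upto_zero vanishes_to_zero)
  ultimately show False using assms(2) by auto
qed

section \<open>Choosing the exponents\<close>

text \<open>Subtracting \<open>n - k\<close> from the \<open>i\<close>-th entry embeds these lists into the lists of the same
  length with sum \<open>k\<close>.\<close>

lemma card_lists_large_entry_le:
  assumes "i \<le> d" "k \<le> n"
  shows "card {l :: nat list. length l = d + 1 \<and> sum_list l = n \<and> n - k \<le> l ! i}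
    \<le> (k + d) choose d"
proof -
  let ?A = "{l :: nat list. length l = d + 1 \<and> sum_list l = n \<and> n - k \<le> l ! i}"
  let ?B = "{l :: nat list. length l = d + 1 \<and> sum_list l = k}"
  let ?f = "\<lambda>l. l[i := l ! i - (n - k)]"
  have "inj_on ?f ?A"
  proof (rule inj_onI, goal_cases)
    case (1 x y)
    have "x ! j = y ! j" if "j < length x" for j
      using 1 assms that by (cases "j = i") (auto dest!: arg_cong[of _ _ "\<lambda>l. l ! j"])
    with 1 show ?case by (auto intro: nth_equalityI)
  qed
  moreover have "?f ` ?A \<subseteq> ?B"
    using assms by (auto simp: sum_list_update)
  moreover have "finite ?B"
    by (rule finite_subset[OF _ finite_lists_length_eq[of "{..k}" "d + 1"]])
       (auto intro: member_le_sum_list)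
  ultimately have "card ?A \<le> card ?B"
    by (rule card_inj_on_le)
  also have "\<dots> = (k + d) choose d"
    using card_length_sum_list[of "d + 1" k] binomial_symmetric[of d "k + d"] by simp
  finally show ?thesis .
qed

text \<open>The counting hypothesis is the borderline case of the union bound: if the sets \<open>A q\<close> of
  exponent vectors that are forbidden at \<open>q\<close> covered everything, there would be no room for any
  overlap. Disjointness in turn makes the numbers \<open>p q\<close> so small that covering fails.\<close>

lemma exists_exponents:
  fixes p :: "nat \<Rightarrow> nat"
  assumes "2 \<le> d"
    and count: "(n + d) choose d = (\<Sum>q\<le>d. (p q + d) choose d)"
    and lt: "\<And>q. q \<le> d \<Longrightarrow> p q < n"
    and "2 \<le> n"
  shows "\<exists>\<beta>. length \<beta> = d + 1 \<and> sum_list \<beta> = n \<and> (\<forall>q\<le>d. \<beta> ! q + p q < n)"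
proof (rule ccontr)
  assume none: "\<not> ?thesis"
  define U where "U = {l :: nat list. length l = d + 1 \<and> sum_list l = n}"
  define A where "A q = {l :: nat list. length l = d + 1 \<and> sum_list l = n \<and> n - p q \<le> l ! q}" for q
  have finU: "finite U"
    unfolding U_def
    by (rule finite_subset[OF _ finite_lists_length_eq[of "{..n}" "d + 1"]])
       (auto intro: member_le_sum_list)
  have AU: "A q \<subseteq> U" for q by (auto simp: A_def U_def)
  then have finA: "finite (A q)" for q using finU by (rule finite_subset)
  have "U \<subseteq> (\<Union>q\<le>d. A q)"
    using none lt unfolding U_def A_def by fastforce
  have cardU: "card U = (\<Sum>q\<le>d. (p q + d) choose d)"
    using card_length_sum_list[of "d + 1" n] binomial_symmetric[of d "n + d"]
    by (simp add: U_def flip: count)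
  have cardA: "card (A q) \<le> (p q + d) choose d" if "q \<le> d" for q
    using card_lists_large_entry_le[of q d "p q" n] that lt[of q] by (simp add: A_def)
  \<comment> \<open>An overlap would make the union bound strict and leave \<open>U\<close> too large to be covered.\<close>
  have disj: "A a \<inter> A b = {}" if ab: "a \<le> d" "b \<le> d" "a \<noteq> b" for a b
  proof (rule ccontr)
    assume "A a \<inter> A b \<noteq> {}"
    then have "card (A a \<inter> A b) > 0" using finA by (simp add: card_gt_0_iff)
    then have "card (A b - A a) < card (A b)"
      using card_Diff_subset_Int[of "A b" "A a"] finA[of b] card_mono[of "A b" "A b \<inter> A a"]
      by (simp add: Int_commute)
    moreover have "U \<subseteq> (\<Union>q\<in>{..d} - {b}. A q) \<union> (A b - A a)"
      using \<open>U \<subseteq> (\<Union>q\<le>d. A q)\<close> ab by blast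
    then have "card U \<le> card ((\<Union>q\<in>{..d} - {b}. A q) \<union> (A b - A a))"
      using finA by (intro card_mono) auto
    moreover have "\<dots> \<le> (\<Sum>q\<in>{..d} - {b}. card (A q)) + card (A b - A a)"
      by (rule order_trans[OF card_Un_le]) (auto intro: card_UN_le)
    moreover have "(\<Sum>q\<in>{..d} - {b}. card (A q)) \<le> (\<Sum>q\<in>{..d} - {b}. (p q + d) choose d)"
      using cardA by (intro sum_mono) auto
    moreover have "(\<Sum>q\<le>d. (p q + d) choose d) =
        ((p b + d) choose d) + (\<Sum>q\<in>{..d} - {b}. (p q + d) choose d)"
      using ab by (intro sum.remove) auto
    ultimately show False
      using cardU cardA[OF ab(2)] by linarith
  qed
  have pair: "p a + p b < n" if ab: "a \<le> d" "b \<le> d" "a \<noteq> b" for a b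
  proof (rule ccontr)
    assume "\<not> p a + p b < n"
    \<comment> \<open>The vector with entries \<open>n - p a\<close> at \<open>a\<close> and \<open>p a\<close> at \<open>b\<close> lies in both sets.\<close>
    define l where "l = (replicate (d + 1) 0)[a := n - p a, b := p a]"
    have "length l = d + 1" "l ! a = n - p a" "l ! b = p a"
      using ab by (simp_all add: l_def del: replicate_Suc)
    moreover have "sum_list l = n"
      using ab lt[of a]
      by (simp add: l_def sum_list_update sum_list_replicate del: replicate_Suc)
    ultimately have "l \<in> A a \<inter> A b"
      using \<open>\<not> p a + p b < n\<close> by (simp add: A_def)
    then show False using disj[OF ab] by simp
  qed
  have pair01: "p 0 + p 1 < n" and pair02: "p 0 + p 2 < n" and pair12: "p 1 + p 2 < n"
    using pair[of 0 1] pair[of 0 2] pair[of 1 2] \<open>2 \<le> d\<close> by simp_all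
  \<comment> \<open>Distribute \<open>n\<close> greedily over three coordinates with capacities \<open>n - 1 - p q\<close>. Adding the
    three pair bounds gives \<open>2 * (p 0 + p 1 + p 2) \<le> 3 * (n - 1)\<close>, so by integrality
    \<open>p 0 + p 1 + p 2 \<le> 2 * n - 3\<close> for \<open>n \<ge> 2\<close>: the capacities add up to at least \<open>n\<close>.\<close>
  define x y where "x = n - 1 - p 0" and "y = min (n - x) (n - 1 - p 1)"
  define z where "z = n - x - y"
  define \<beta> where "\<beta> = [x, y, z] @ replicate (d - 2) 0"
  have xyz: "x + y + z = n" "x + p 0 < n" "y + p 1 < n" "z + p 2 < n"
    using pair01 pair02 pair12 \<open>2 \<le> n\<close> unfolding x_def y_def z_def by linarith+
  have "\<beta> ! q + p q < n" if "q \<le> d" for q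
  proof -
    consider "q = 0" | "q = 1" | "q = 2" | "q > 2" by linarith
    then show ?thesis
      using xyz lt[OF that] that by cases (auto simp: \<beta>_def nth_append numeral_2_eq_2)
  qed
  moreover have "length \<beta> = d + 1" "sum_list \<beta> = n"
    using assms xyz by (auto simp: \<beta>_def sum_list_replicate)
  ultimately show False using none by blast
qed

section \<open>The vanishing polynomial\<close>

text \<open>Affine functions on \<open>real ^ 'd\<close> correspond to linear forms on the space of one more
  dimension, where a point \<open>x\<close> becomes \<open>(x, 1)\<close>. There, \<open>CARD('d)\<close> vectors cannot span, so some
  nonzero vector is orthogonal to all of them.\<close>

lemma exists_affine_function_vanishing_on:
  fixes S :: "(real ^ 'd::finite) set"
  assumes "finite S" "card S \<le> CARD('d)"
  shows "\<exists>u c. (\<exists>z. u \<bullet> z + c \<noteq> 0) \<and> (\<forall>x\<in>S. u \<bullet> x + c = 0)"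
proof -
  let ?T = "(\<lambda>x. (x, 1 :: real)) ` S"
  have "dim ?T \<le> card ?T"
    using assms(1) by (intro dim_le_card') auto
  also have "\<dots> \<le> CARD('d)"
    using card_image_le[OF assms(1)] assms(2) by (rule order_trans)
  finally have "dim ?T < DIM((real ^ 'd) \<times> real)" by simp
  then obtain w where w: "w \<noteq> 0" "\<And>y. y \<in> span ?T \<Longrightarrow> orthogonal w y"
    using orthogonal_to_subspace_exists by blast
  obtain u c where uc: "w = (u, c)" by force
  have "u \<bullet> x + c = 0" if "x \<in> S" for x
    using w(2)[OF span_base, of "(x, 1)"] that by (auto simp: uc orthogonal_def)
  moreover have "\<exists>z. u \<bullet> z + c \<noteq> 0"
  proof (cases "c = 0")
    case True
    with w(1) uc have "u \<bullet> u + c \<noteq> 0" by (simp add: zero_prod_def)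
    then show ?thesis by blast
  next
    case False
    then have "u \<bullet> 0 + c \<noteq> 0" by simp
    then show ?thesis by blast
  qed
  ultimately show ?thesis by blast
qed

lemma real_polynomial_function_affine: "real_polynomial_function (\<lambda>x. u \<bullet> x + c)"
  by (intro real_polynomial_function.intros bounded_linear_inner_right)

lemma not_hermite_regular_if_in_hyperplane:
  assumes "\<And>q. q \<in> {1..m} \<Longrightarrow> u \<bullet> X q + c = 0" "u \<bullet> z + c \<noteq> 0"
    and "\<And>q. q \<in> {1..m} \<Longrightarrow> p q < n"
  shows "\<not> hermite_regular n m p X"
proof (rule not_hermite_regular_if_nonzero_vanishing)
  show "(\<lambda>x. (u \<bullet> x + c) ^ n) \<in> polys_upto n"
    by (intro polys_upto_power polys_upto_affine)
  show "(u \<bullet> z + c) ^ n \<noteq> 0" using assms(2) by simp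
  show "vanishes_to (X q) (Suc (p q)) (\<lambda>x. (u \<bullet> x + c) ^ n)" if "q \<in> {1..m}" for q
  proof (rule vanishes_to_mono)
    show "vanishes_to (X q) n (\<lambda>x. (u \<bullet> x + c) ^ n)"
      using assms(1)[OF that] by (rule vanishes_to_power[OF real_polynomial_function_affine])
    show "Suc (p q) \<le> n"
      using assms(3)[OF that] by (rule Suc_leI)
  qed
qed

text \<open>The product of the powers of the facet functions is nonzero at the barycentre \<open>z\<close> of the
  nodes: averaging \<open>l\<^sub>q\<close> over the nodes shows that \<open>m * l\<^sub>q z\<close> equals \<open>l\<^sub>q (X q)\<close>.\<close>

lemma not_hermite_regular_if_simplex:
  fixes X :: "nat \<Rightarrow> real ^ 'd::finite"
  assumes "1 \<le> m"
    and zero: "\<And>q r. q \<in> {1..m} \<Longrightarrow> r \<in> {1..m} \<Longrightarrow> r \<noteq> q \<Longrightarrow> u q \<bullet> X r + c q = 0"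
    and nonzero: "\<And>q. q \<in> {1..m} \<Longrightarrow> u q \<bullet> X q + c q \<noteq> 0"
    and \<beta>: "(\<Sum>q=1..m. \<beta> q) = n" "\<And>q. q \<in> {1..m} \<Longrightarrow> \<beta> q + p q < n"
  shows "\<not> hermite_regular n m p X"
proof (rule not_hermite_regular_if_nonzero_vanishing)
  let ?l = "\<lambda>q x. u q \<bullet> x + c q"
  let ?f = "\<lambda>x. \<Prod>q=1..m. ?l q x ^ \<beta> q"
  let ?z = "(1 / real m) *\<^sub>R (\<Sum>r=1..m. X r)"
  show "?f \<in> polys_upto n"
    unfolding \<beta>(1)[symmetric] by (intro polys_upto_prod polys_upto_power polys_upto_affine)
  have "?l q ?z \<noteq> 0" if q: "q \<in> {1..m}" for q
  proof -
    have "real m * ?l q ?z = (\<Sum>r=1..m. ?l q (X r))"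
      using assms(1) by (simp add: inner_sum_right sum.distrib distrib_left)
    also have "\<dots> = ?l q (X q) + (\<Sum>r\<in>{1..m} - {q}. ?l q (X r))"
      using q by (intro sum.remove) auto
    also have "(\<Sum>r\<in>{1..m} - {q}. ?l q (X r)) = 0"
      using zero[OF q] by (intro sum.neutral) auto
    finally show ?thesis using nonzero[OF q] by auto
  qed
  then show "?f ?z \<noteq> 0" by (simp add: prod_zero_iff)
  show "vanishes_to (X r) (Suc (p r)) ?f" if r: "r \<in> {1..m}" for r
  proof -
    have "vanishes_to (X r) (\<Sum>q=1..m. if q = r then 0 else \<beta> q) ?f"
    proof (intro vanishes_to_prod real_polynomial_function_power real_polynomial_function_affine)
      show "vanishes_to (X r) (if q = r then 0 else \<beta> q) (\<lambda>x. ?l q x ^ \<beta> q)"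
        if "q \<in> {1..m}" for q
        using vanishes_to_power[OF real_polynomial_function_affine, of "u q" "X r" "c q"]
          zero[OF that r] by auto
    qed simp
    moreover have "(\<Sum>q=1..m. if q = r then 0 else \<beta> q) + \<beta> r = n"
      using r \<beta>(1) by (simp add: sum.remove[of _ r])
    then have "Suc (p r) \<le> (\<Sum>q=1..m. if q = r then 0 else \<beta> q)"
      using \<beta>(2)[OF r] by linarith
    ultimately show ?thesis by (rule vanishes_to_mono)
  qed
qed

theorem theorem6:
  fixes n m :: nat and p :: "nat \<Rightarrow> nat"
  assumes "2 \<le> CARD('d::finite)"
    and "2 \<le> m" and "m \<le> CARD('d) + 1"
    and "mono_on {1..m} p"
    and "(n + CARD('d)) choose CARD('d) = (\<Sum>q=1..m. (p q + CARD('d)) choose CARD('d))"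
    and "\<not> (\<forall>q\<in>{1..m}. p q = 0)"
  shows "scheme_singular TYPE('d) n m p"
  unfolding scheme_singular_def
proof (intro allI impI)
  fix X :: "nat \<Rightarrow> real ^ 'd"
  let ?d = "CARD('d)"
  have lt: "p q < n" if q: "q \<in> {1..m}" for q
  proof (rule ccontr)
    assume "\<not> p q < n"
    \<comment> \<open>Any second node contributes a positive summand to the dimension count.\<close>
    define r where "r = (if q = 1 then 2 else 1 :: nat)"
    then have r: "r \<in> {1..m}" "r \<noteq> q"
      using assms(2) by auto
    have "(n + ?d) choose ?d \<le> (p q + ?d) choose ?d"
      using \<open>\<not> p q < n\<close> by (intro binomial_right_mono) auto
    moreover have "(\<Sum>i\<in>{q, r}. (p i + ?d) choose ?d) \<le> (\<Sum>i=1..m. (p i + ?d) choose ?d)"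
      using q r by (intro sum_mono2) auto
    moreover have "(p r + ?d) choose ?d > 0" by simp
    ultimately show False using assms(5) r(2) by simp
  qed
  show "\<not> hermite_regular n m p X"
  proof (cases "\<exists>u c. (\<exists>z. u \<bullet> z + c \<noteq> 0) \<and> (\<forall>q\<in>{1..m}. u \<bullet> X q + c = 0)")
    case True
    then show ?thesis
      using not_hermite_regular_if_in_hyperplane lt by blast
  next
    case False
    have m: "m = ?d + 1"
    proof (rule ccontr)
      assume "m \<noteq> ?d + 1"
      then have "card (X ` {1..m}) \<le> ?d"
        using card_image_le[of "{1..m}" X] assms(3) by simp
      then show False
        using exists_affine_function_vanishing_on[of "X ` {1..m}"] False by fastforce
    qed
    have "\<exists>u c. (\<exists>z. u \<bullet> z + c \<noteq> 0) \<and> (\<forall>r\<in>{1..m} - {q}. u \<bullet> X r + c = 0)" if "q \<in> {1..m}" for q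
    proof -
      have "card (X ` ({1..m} - {q})) \<le> ?d"
        using card_image_le[of "{1..m} - {q}" X] m that by simp
      then show ?thesis
        using exists_affine_function_vanishing_on[of "X ` ({1..m} - {q})"] by simp
    qed
    then obtain u c where uc: "\<And>q. q \<in> {1..m} \<Longrightarrow> \<exists>z. u q \<bullet> z + c q \<noteq> 0"
      "\<And>q r. q \<in> {1..m} \<Longrightarrow> r \<in> {1..m} - {q} \<Longrightarrow> u q \<bullet> X r + c q = 0"
      by metis
    \<comment> \<open>A zero at the remaining node would put all nodes on one hyperplane.\<close>
    have nonzero: "u q \<bullet> X q + c q \<noteq> 0" if "q \<in> {1..m}" for q
      using uc[OF that] False by blast
    obtain q where "q \<in> {1..m}" "p q \<noteq> 0"
      using assms(6) by blast
    then have n: "2 \<le> n"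
      using lt[of q] by linarith
    have count: "(n + ?d) choose ?d = (\<Sum>q\<le>?d. (p (Suc q) + ?d) choose ?d)"
      using assms(5) sum.shift_bounds_cl_Suc_ivl[of "\<lambda>q. (p q + ?d) choose ?d" 0 ?d] m
      by (simp add: atMost_atLeast0 del: sum.cl_ivl_Suc)
    have "p (Suc q) < n" if "q \<le> ?d" for q
      using lt[of "Suc q"] that m by simp
    from exists_exponents[OF assms(1) count this n]
    obtain \<beta> where \<beta>: "length \<beta> = ?d + 1" "sum_list \<beta> = n"
      "\<And>q. q \<le> ?d \<Longrightarrow> \<beta> ! q + p (Suc q) < n"
      by blast
    show ?thesis
    proof (rule not_hermite_regular_if_simplex)
      show "(\<Sum>q=1..m. \<beta> ! (q - 1)) = n"
        using \<beta>(1,2) m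
        by (simp add: sum_list_sum_nth sum.atLeast1_atMost_eq atLeast0LessThan)
      show "\<beta> ! (q - 1) + p q < n" if "q \<in> {1..m}" for q
        using \<beta>(3)[of "q - 1"] that m by auto
    qed (use assms(2) uc nonzero in auto)
  qed
qed

end
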